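(* Let $G$ be a finite simple connected graph with $m\geq 1$ edges, maximum degree $\Delta$ and minimum degree $\delta$. Then $$SDD(G)\leq m\left(\frac{\Delta}{\delta}+\frac{\delta}{\Delta}\right),$$ with equality if and only if $G$ is regular or biregular.
   Context: For a finite simple graph $G$ with edge set $E_G$, $d_u$ denotes the degree of vertex $u$, and the symmetric division deg index is $SDD(G)=\sum_{uv\in E_G}\left(\frac{d_u}{d_v}+\frac{d_v}{d_u}\right)$. A graph is $(\Delta,\delta)$-biregular if it is bipartite and every edge joins a vertex of degree $\Delta$ (in one part) to a vertex of degree $\delta$ (in the other part); it is biregular if it is $(\Delta,\delta)$-biregular with $\Delta$ its maximum degree and $\delta$ its minimum degree. *)

theory Defs
  imports Complex_Main
begin

text \<open>A simple graph is given by its vertex set and its edge set, an edge being the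
  two-element set of its end vertices.\<close>

locale finite_simple_graph =
  fixes V :: "'a set" and E :: "'a set set"
  assumes finite_vertices: "finite V"
    and edges: "\<And>e. e \<in> E \<Longrightarrow> e \<subseteq> V \<and> card e = 2"

definition degree :: "'a set set \<Rightarrow> 'a \<Rightarrow> nat" where
  "degree E v = card {e \<in> E. v \<in> e}"

definition max_degree :: "'a set \<Rightarrow> 'a set set \<Rightarrow> nat" where
  "max_degree V E = Max (degree E ` V)"

definition min_degree :: "'a set \<Rightarrow> 'a set set \<Rightarrow> nat" where
  "min_degree V E = Min (degree E ` V)"

definition connected_graph :: "'a set \<Rightarrow> 'a set set \<Rightarrow> bool" where
  "connected_graph V E \<longleftrightarrow>
     V \<noteq> {} \<and> (\<forall>u\<in>V. \<forall>v\<in>V. (u, v) \<in> {(x, y). {x, y} \<in> E}\<^sup>*)"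

definition regular_graph :: "'a set \<Rightarrow> 'a set set \<Rightarrow> bool" where
  "regular_graph V E \<longleftrightarrow> (\<exists>k. \<forall>v\<in>V. degree E v = k)"

definition biregular_with :: "nat \<Rightarrow> nat \<Rightarrow> 'a set \<Rightarrow> 'a set set \<Rightarrow> bool" where
  "biregular_with a b V E \<longleftrightarrow>
     (\<exists>A B. A \<union> B = V \<and> A \<inter> B = {} \<and>
        (\<forall>e\<in>E. \<exists>u\<in>A. \<exists>v\<in>B. e = {u, v} \<and> degree E u = a \<and> degree E v = b))"

definition biregular :: "'a set \<Rightarrow> 'a set set \<Rightarrow> bool" where
  "biregular V E \<longleftrightarrow> biregular_with (max_degree V E) (min_degree V E) V E"

text \<open>The contribution of an unordered edge is written as a sum over its two orderings, so that
  no choice of orientation is needed; \<open>edge_weight_doubleton\<close> gives the usual form.\<close>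

definition edge_weight :: "'a set set \<Rightarrow> 'a set \<Rightarrow> real" where
  "edge_weight E e = (\<Sum>u\<in>e. \<Sum>v\<in>e - {u}. real (degree E u) / real (degree E v))"

lemma edge_weight_doubleton:
  assumes "u \<noteq> v"
  shows "edge_weight E {u, v} =
    real (degree E u) / real (degree E v) + real (degree E v) / real (degree E u)"
proof -
  have "{u, v} - {u} = {v}" "{u, v} - {v} = {u}"
    using assms by auto
  then show ?thesis
    using assms by (simp add: edge_weight_def)
qed

definition SDD :: "'a set set \<Rightarrow> real" where
  "SDD E = (\<Sum>e\<in>E. edge_weight E e)"

end

theory Submission imports Defs
begin

text \<open>The bound holds edge by edge: clearing denominators, the gap between
  \<open>\<Delta>/\<delta> + \<delta>/\<Delta>\<close> and \<open>a/b + b/a\<close> becomes \<open>(\<Delta>a - \<delta>b)(\<Delta>b - \<delta>a)\<close>, and both factors are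
  nonnegative for \<open>a, b\<close> between \<open>\<delta>\<close> and \<open>\<Delta>\<close>. The gap vanishes exactly when \<open>{a, b} = {\<Delta>, \<delta>}\<close>,
  so equality means that every edge joins degree \<open>\<Delta>\<close> to degree \<open>\<delta>\<close>. If \<open>\<Delta> = \<delta>\<close> the graph is
  regular, and otherwise the vertices of degree \<open>\<Delta>\<close> form one side of a bipartition.\<close>

lemma ratio_sum_gap:
  fixes a b c d :: real
  assumes "a > 0" "b > 0" "c > 0" "d > 0"
  shows "(c / d + d / c) - (a / b + b / a) = (c * a - d * b) * (c * b - d * a) / (a * b * c * d)"
  using assms by (simp add: field_simps)

lemma ratio_sum_le:
  fixes a b c d :: real
  assumes "d > 0" "d \<le> a" "a \<le> c" "d \<le> b" "b \<le> c"
  shows "a / b + b / a \<le> c / d + d / c"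
proof -
  have pos: "a > 0" "b > 0" "c > 0"
    using assms by linarith+
  \<comment> \<open>Both factors of the gap are nonnegative: \<open>b \<le> c\<close> is paired with
    \<open>d \<le> a\<close>, and \<open>a \<le> c\<close> with \<open>d \<le> b\<close>.\<close>
  have "b * d \<le> c * a" "a * d \<le> c * b"
    using assms pos by (auto intro!: mult_mono)
  then have "0 \<le> (c * a - d * b) * (c * b - d * a) / (a * b * c * d)"
    using assms pos by (simp add: mult.commute)
  then show ?thesis
    using ratio_sum_gap[of a b c d] assms pos by linarith
qed

text \<open>Since \<open>b \<le> c\<close>, the product \<open>d * b\<close> is at most
  \<open>d * c\<close>, and cancelling \<open>c\<close> leaves \<open>a \<le> d\<close>. So a
  vanishing factor of the gap pins one variable to \<open>d\<close>; the equation itself then pins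
  the other to \<open>c\<close>.\<close>

lemma mult_extremes_eq:
  fixes a b c d :: real
  assumes "d > 0" "c > 0" "d \<le> a" "b \<le> c" "c * a = d * b"
  shows "a = d"
proof -
  have "c * a \<le> c * d"
    using assms by (simp add: mult.commute)
  then have "a \<le> d"
    using assms(2) by simp
  then show ?thesis
    using assms(3) by simp
qed

lemma ratio_sum_eq_iff:
  fixes a b c d :: real
  assumes "d > 0" "d \<le> a" "a \<le> c" "d \<le> b" "b \<le> c"
  shows "a / b + b / a = c / d + d / c \<longleftrightarrow> a = c \<and> b = d \<or> a = d \<and> b = c"
proof
  have pos: "a > 0" "b > 0" "c > 0"
    using assms by linarith+
  assume "a / b + b / a = c / d + d / c"
  then have "(c * a - d * b) * (c * b - d * a) / (a * b * c * d) = 0"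
    using ratio_sum_gap[of a b c d] assms pos by linarith
  \<comment> \<open>Each factor accounts for one of the two assignments of the extremes: the first
    yields \<open>a = d\<close> and \<open>b = c\<close>, the second \<open>b = d\<close> and
    \<open>a = c\<close>.\<close>
  then consider "c * a = d * b" | "c * b = d * a"
    using assms pos by auto
  then show "a = c \<and> b = d \<or> a = d \<and> b = c"
  proof cases
    case 1
    then have "a = d"
      using mult_extremes_eq[of d c a b] assms pos by simp
    then show ?thesis
      using 1 assms by simp
  next
    case 2
    then have "b = d"
      using mult_extremes_eq[of d c b a] assms pos by simp
    then show ?thesis
      using 2 assms by simp
  qed
qed auto

context finite_simple_graph
begin

lemma finite_edges: "finite E"
proof -
  have "E \<subseteq> Pow V"
    using edges by blast
  then show ?thesis
    using finite_vertices finite_subset by blast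
qed

lemma edge_endpoints:
  assumes "e \<in> E"
  obtains u v where "e = {u, v}" "u \<noteq> v" "u \<in> V" "v \<in> V"
proof -
  have "e \<subseteq> V" "card e = 2"
    using edges[OF assms] by auto
  moreover from \<open>card e = 2\<close> obtain u v where "e = {u, v}" "u \<noteq> v"
    unfolding card_2_iff by blast
  ultimately show ?thesis
    using that by blast
qed

lemma degree_le_max: "v \<in> V \<Longrightarrow> degree E v \<le> max_degree V E"
  by (simp add: max_degree_def finite_vertices)

lemma min_le_degree: "v \<in> V \<Longrightarrow> min_degree V E \<le> degree E v"
  by (simp add: min_degree_def finite_vertices)

text \<open>An edge has two endpoints, so some vertex differs from \<open>v\<close>, and a path from
  \<open>v\<close> to it must leave \<open>v\<close> along an edge. Having an edge excludes the
  one-vertex graph, where the degree is 0.\<close>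

lemma degree_pos:
  assumes "connected_graph V E" "E \<noteq> {}" "v \<in> V"
  shows "degree E v > 0"
proof -
  obtain e where "e \<in> E"
    using assms by blast
  then obtain w where w: "w \<in> V" "w \<noteq> v"
    by (rule edge_endpoints) metis
  have "(v, w) \<in> {(x, y). {x, y} \<in> E}\<^sup>*"
    using assms w by (simp add: connected_graph_def)
  \<comment> \<open>As \<open>w \<noteq> v\<close>, the path is not empty and has a first
    edge.\<close>
  then obtain y where "{v, y} \<in> E"
    using w by (auto elim: converse_rtranclE)
  then have "{e \<in> E. v \<in> e} \<noteq> {}"
    by blast
  then show ?thesis
    by (simp add: degree_def card_gt_0_iff finite_edges)
qed

text \<open>The minimum is attained at some vertex. Its positivity supplies the hypothesis
  \<open>d > 0\<close> of the ratio lemmas.\<close>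

lemma min_degree_pos:
  assumes "connected_graph V E" "E \<noteq> {}"
  shows "min_degree V E > 0"
proof -
  have "min_degree V E \<in> degree E ` V"
    unfolding min_degree_def using assms(1) finite_vertices
    by (intro Min_in) (simp_all add: connected_graph_def)
  then show ?thesis
    using degree_pos[OF assms] by fastforce
qed

lemma edge_weight_le:
  assumes "min_degree V E > 0" "e \<in> E"
  shows "edge_weight E e \<le> real (max_degree V E) / real (min_degree V E)
    + real (min_degree V E) / real (max_degree V E)"
proof -
  obtain u v where "e = {u, v}" "u \<noteq> v" "u \<in> V" "v \<in> V"
    using edge_endpoints[OF assms(2)] .
  then show ?thesis
    using assms degree_le_max min_le_degree
    by (simp add: edge_weight_doubleton ratio_sum_le)
qed

lemma edge_weight_eq_iff:
  assumes "min_degree V E > 0" "e \<in> E"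
  shows "edge_weight E e = real (max_degree V E) / real (min_degree V E)
      + real (min_degree V E) / real (max_degree V E) \<longleftrightarrow>
    (\<exists>u v. e = {u, v} \<and> degree E u = max_degree V E \<and> degree E v = min_degree V E)"
proof -
  obtain u v where e: "e = {u, v}" "u \<noteq> v" "u \<in> V" "v \<in> V"
    using edge_endpoints[OF assms(2)] .
  then have "edge_weight E e = real (max_degree V E) / real (min_degree V E)
      + real (min_degree V E) / real (max_degree V E) \<longleftrightarrow>
    degree E u = max_degree V E \<and> degree E v = min_degree V E \<or>
    degree E u = min_degree V E \<and> degree E v = max_degree V E"
    using assms degree_le_max min_le_degree
    by (simp add: edge_weight_doubleton ratio_sum_eq_iff)
  \<comment> \<open>The two cases are the two ways of naming the endpoints of the unordered edge, so
    one existential covers both.\<close>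
  also have "\<dots> \<longleftrightarrow>
    (\<exists>u v. e = {u, v} \<and> degree E u = max_degree V E \<and> degree E v = min_degree V E)"
    unfolding e(1) doubleton_eq_iff by metis
  finally show ?thesis .
qed

lemma extremal_edges_iff:
  assumes "V \<noteq> {}"
  shows "(\<forall>e\<in>E. \<exists>u v. e = {u, v} \<and> degree E u = max_degree V E \<and> degree E v = min_degree V E)
    \<longleftrightarrow> regular_graph V E \<or> biregular V E"
    (is "?extremal \<longleftrightarrow> _")
proof
  assume ext: ?extremal
  show "regular_graph V E \<or> biregular V E"
  proof (cases "max_degree V E = min_degree V E")
    case True
    then have "degree E v = max_degree V E" if "v \<in> V" for v
      using degree_le_max[OF that] min_le_degree[OF that] by simp
    then show ?thesis
      by (auto simp: regular_graph_def)
  next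
    case False
    \<comment> \<open>Because the extreme degrees differ, an endpoint of minimum degree cannot lie
      in \<open>A\<close> and falls into \<open>V - A\<close>.\<close>
    define A where "A = {v \<in> V. degree E v = max_degree V E}"
    have "\<exists>u\<in>A. \<exists>v\<in>V - A. e = {u, v} \<and>
        degree E u = max_degree V E \<and> degree E v = min_degree V E" if "e \<in> E" for e
    proof -
      obtain u v where uv: "e = {u, v}" "degree E u = max_degree V E" "degree E v = min_degree V E"
        using ext \<open>e \<in> E\<close> by blast
      then have "u \<in> A" "v \<in> V - A"
        using False edges[OF \<open>e \<in> E\<close>] by (simp_all add: A_def)
      then show ?thesis
        using uv by blast
    qed
    moreover have "A \<union> (V - A) = V" "A \<inter> (V - A) = {}"
      by (auto simp: A_def)
    ultimately have "biregular V E"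
      unfolding biregular_def biregular_with_def by blast
    then show ?thesis ..
  qed
next
  assume "regular_graph V E \<or> biregular V E"
  then show ?extremal
  proof
    assume "regular_graph V E"
    then obtain k where k: "\<And>v. v \<in> V \<Longrightarrow> degree E v = k"
      by (auto simp: regular_graph_def)
    then have "degree E ` V = {k}"
      using assms by auto
    \<comment> \<open>With both extremes equal to \<open>k\<close>, any naming of the endpoints of
      an edge serves as witness.\<close>
    then have "max_degree V E = k" "min_degree V E = k"
      by (simp_all add: max_degree_def min_degree_def)
    moreover have "\<exists>u v. e = {u, v} \<and> degree E u = k \<and> degree E v = k" if "e \<in> E" for e
      using edge_endpoints[OF that] k by metis
    ultimately show ?extremal
      by simp
  next
    assume "biregular V E"
    then show ?extremal
      unfolding biregular_def biregular_with_def by blast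
  qed
qed

end

text \<open>The defects \<open>c - f x\<close> are nonnegative, so their sum is zero only if each of
  them is. This passes from equality in the total to equality on every edge.\<close>

lemma sum_eq_card_mult_iff:
  fixes f :: "'b \<Rightarrow> real"
  assumes "finite S" "\<And>x. x \<in> S \<Longrightarrow> f x \<le> c"
  shows "sum f S = real (card S) * c \<longleftrightarrow> (\<forall>x\<in>S. f x = c)"
proof -
  have "sum f S = real (card S) * c \<longleftrightarrow> (\<Sum>x\<in>S. c - f x) = 0"
    unfolding sum_subtractf sum_constant by linarith
  also have "\<dots> \<longleftrightarrow> (\<forall>x\<in>S. c - f x = 0)"
    using assms by (intro sum_nonneg_eq_0_iff) auto
  finally show ?thesis
    unfolding right_minus_eq by metis
qed

theorem theorem3p4:
  fixes V :: "'a set" and E :: "'a set set" and m \<Delta> \<delta> :: nat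
  assumes "finite_simple_graph V E"
    and "connected_graph V E"
    and "m = card E" and "m \<ge> 1"
    and "\<Delta> = max_degree V E" and "\<delta> = min_degree V E"
  shows "SDD E \<le> real m * (real \<Delta> / real \<delta> + real \<delta> / real \<Delta>) \<and>
    (SDD E = real m * (real \<Delta> / real \<delta> + real \<delta> / real \<Delta>) \<longleftrightarrow>
       regular_graph V E \<or> biregular V E)"
proof -
  interpret finite_simple_graph V E
    by fact
  \<comment> \<open>\<open>m \<ge> 1\<close> enters here: it makes \<open>E\<close>
    nonempty.\<close>
  have pos: "min_degree V E > 0"
    using assms by (intro min_degree_pos) auto
  have "V \<noteq> {}"
    using assms by (simp add: connected_graph_def)
  note le = edge_weight_le[OF pos, folded assms(5,6)]
  have "SDD E \<le> real m * (real \<Delta> / real \<delta> + real \<delta> / real \<Delta>)"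
    unfolding SDD_def assms(3) using le by (rule sum_bounded_above)
  moreover have "SDD E = real m * (real \<Delta> / real \<delta> + real \<delta> / real \<Delta>) \<longleftrightarrow>
      (\<forall>e\<in>E. edge_weight E e = real \<Delta> / real \<delta> + real \<delta> / real \<Delta>)"
    unfolding SDD_def assms(3) using finite_edges le by (rule sum_eq_card_mult_iff)
  moreover have "\<dots> \<longleftrightarrow> regular_graph V E \<or> biregular V E"
    using edge_weight_eq_iff[OF pos] extremal_edges_iff[OF \<open>V \<noteq> {}\<close>] assms(5,6) by simp
  ultimately show ?thesis
    by blast
qed

end
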